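(* In the setting of the context (in particular $f$ convex and constant step-size $\gamma$), let $x^*$ be an optimal point of $\min_{x\in\mathcal{X}}h(x)$ and define $$\sigma:=\frac{(\tau-\gamma L_{\nabla f})\,\gamma\,p_{\min}}{4\left((Q+L_g)^2+nL^2R^2\right)},\qquad \widetilde\sigma:=\frac{(\tau-\gamma L_{\nabla f})\,\gamma}{6n\theta(1-\gamma)^2},$$ where $L:=\max_i L_i$ and $\theta:=L_g^2+\widehat Q^2+2nR^2\widetilde L^2\frac{\gamma^2}{(1-\gamma)^2}+2R^2L^2$ (for the quantities $\widetilde\sigma,\theta$ it is assumed that $\gamma<1$). Then for all $r\ge 1$: (i) for the randomized rule, $$\mathbb{E}[h(x^r)]-h(x^* )\le\frac{\max\{4\sigma-2,\ h(x^0)-h(x^* ),\ 2\}}{\sigma}\cdot\frac1r;$$ (ii) for the cyclic rule, $$h(x^{mr})-h(x^* )\le\frac{\max\{4\widetilde\sigma-2,\ h(x^0)-h(x^* ),\ 2\}}{\widetilde\sigma}\cdot\frac1r.$$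
   Context: Problem: minimize $h(x)=f(x_1,\dots,x_n)+\sum_{i=1}^n g_i(x_i)$ subject to $x_i\in\mathcal{X}_i$, $i=1,\dots,n$, where each $\mathcal{X}_i\subseteq\mathbb{R}^{m_i}$ is a (nonempty) closed convex set, $\mathcal{X}=\prod_{i=1}^n\mathcal{X}_i$, $f:\mathcal{X}\to\mathbb{R}$ is continuously differentiable and convex, each $g_i:\mathbb{R}^{m_i}\to\mathbb{R}$ is convex (possibly nonsmooth), and $g(x)=\sum_i g_i(x_i)$. $\|\cdot\|$ is the Euclidean norm. Assume $\|\nabla f(x)-\nabla f(y)\|\le L_{\nabla f}\|x-y\|$ for all $x,y\in\mathcal{X}$, and $\inf_{x\in\mathcal{X}}h(x)>-\infty$. Approximations: for each $i$ a function $\widetilde f_i:\mathcal{X}_i\times\mathcal{X}\to\mathbb{R}$ is given such that (1) $\widetilde f_i(\cdot,y)$ is continuously differentiable and uniformly strongly convex with parameter $\tau>0$: $\widetilde f_i(x_i,y)\ge\widetilde f_i(x_i',y)+\langle\nabla_{x_i}\widetilde f_i(x_i',y),x_i-x_i'\rangle+\frac{\tau}{2}\|x_i-x_i'\|^2$ for all $x_i,x_i'\in\mathcal{X}_i$, $y\in\mathcal{X}$; (2) (gradient consistency) $\nabla_{x_i}\widetilde f_i(x_i,x)=\nabla_{x_i}f(x)$ for all $x\in\mathcal{X}$, where $x_i$ is the $i$-th block of $x$ and the gradient of $\widetilde f_i$ is with respect to its first argument; (3) $\|\nabla_{x_i}\widetilde f_i(x_i,y)-\nabla_{x_i}\widetilde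 f_i(x_i,z)\|\le\widetilde L\|y-z\|$ for all $y,z\in\mathcal{X}$, $x_i\in\mathcal{X}_i$, and all $i$. Put $\widetilde h_i(x_i,y)=\widetilde f_i(x_i,y)+g_i(x_i)$. PSCA algorithm: start from a (deterministic) feasible $x^0\in\mathcal{X}$. For $r=0,1,2,\dots$: choose $S^r\subseteq\{1,\dots,n\}$; let $\hat x_i^r=\arg\min_{x_i\in\mathcal{X}_i}\widetilde h_i(x_i,x^r)$ for $i=1,\dots,n$ and $\hat x^r=(\hat x_i^r)_{i=1}^n$; set $x_i^{r+1}=x_i^r+\gamma(\hat x_i^r-x_i^r)$ for $i\in S^r$ and $x_i^{r+1}=x_i^r$ for $i\notin S^r$. Cyclic rule: a partition $\{\mathcal{T}_0,\dots,\mathcal{T}_{m-1}\}$ of $\{1,\dots,n\}$ into pairwise disjoint sets is fixed and $S^{mr+\ell}=\mathcal{T}_\ell$ for all $\ell=0,\dots,m-1$ and all $r$. Randomized rule: the sets $S^r$ are random with $\Pr(j\in S^r\mid x^r,x^{r-1},\dots,x^0)=p_j^r\ge p_{\min}>0$ for all $j=1,\dots,n$ and all $r$. Additional assumptions: the step-size is a constant $\gamma\in(0,1]$ with $\gamma<\tau/L_{\nabla f}$; the level set $\{x\in\mathcal{X}: h(x)\le h(x^0)\}$ is compact; $|g(x)-g(y)|\le L_g\|x-y\|$ for all $x,y\in\mathcal{X}$; and $\|\nabla_{x_i}\widetilde f_i(x_i,y)-\nabla_{x_i}\widetilde f_i(x_i',y)\|\le L_i\|x_i-x_i'\|$ for all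 $x_i,x_i'\in\mathcal{X}_i$, $y\in\mathcal{X}$, and all $i$. Constants: $Q,\widehat Q,R>0$ are constants (which exist because the level set is bounded) such that, for all iterates $x^r$ and all $i$, $\|\nabla f(x^r)\|\le Q$, $\|\nabla_{x_i}\widetilde f_i(\hat x_i^r,x^r)\|\le\widehat Q$, and $\|x^r-x^*\|\le R$. *)

theory Defs
  imports "HOL-Probability.Probability"
begin

text \<open>
  Encoding of the block structure. The blocks are indexed by a finite type \<open>'n\<close>, so the
  number of blocks is \<open>CARD('n)\<close>. Since the block spaces may have different dimensions, the
  \<open>i\<close>-th of them is rendered as an arbitrary linear subspace \<open>V i\<close> of one ambient Euclidean
  space \<open>'a\<close>; its dimension is \<open>dim (V i)\<close>. Every finite family of dimensions arises in this
  way. A block vector is an \<open>x :: 'a ^ 'n\<close> with \<open>x $ i \<in> V i\<close>, and the norm of \<open>'a ^ 'n\<close> is the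
  Euclidean norm of the concatenated vector.
\<close>

definition block_prod :: "('n::finite \<Rightarrow> 'a set) \<Rightarrow> ('a ^ 'n) set" where
  "block_prod Xs = {x. \<forall>i. x $ i \<in> Xs i}"

definition block_sum :: "('n::finite \<Rightarrow> 'a \<Rightarrow> real) \<Rightarrow> 'a ^ 'n \<Rightarrow> real" where
  "block_sum g x = (\<Sum>i\<in>UNIV. g i (x $ i))"

definition objective :: "('a ^ 'n::finite \<Rightarrow> real) \<Rightarrow> ('n \<Rightarrow> 'a \<Rightarrow> real) \<Rightarrow> 'a ^ 'n \<Rightarrow> real" where
  "objective f g x = f x + block_sum g x"

text \<open>
  The functions live only on closed convex sets that may have empty interior, so derivatives are
  taken within the set. A gradient need not be unique then, which is why the gradient map is an
  argument. If \<open>\<phi>\<close> is continuously differentiable near \<open>A\<close>, its ordinary gradient qualifies.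
\<close>

definition cont_diff_on :: "'b::real_inner set \<Rightarrow> ('b \<Rightarrow> real) \<Rightarrow> ('b \<Rightarrow> 'b) \<Rightarrow> bool" where
  "cont_diff_on A \<phi> grad \<longleftrightarrow>
     (\<forall>x\<in>A. (\<phi> has_derivative (\<lambda>d. grad x \<bullet> d)) (at x within A)) \<and> continuous_on A grad"

definition strongly_convex_on ::
  "real \<Rightarrow> 'b::real_inner set \<Rightarrow> ('b \<Rightarrow> real) \<Rightarrow> ('b \<Rightarrow> 'b) \<Rightarrow> bool" where
  "strongly_convex_on \<tau> A \<phi> grad \<longleftrightarrow>
     (\<forall>z\<in>A. \<forall>z'\<in>A. \<phi> z \<ge> \<phi> z' + grad z' \<bullet> (z - z') + \<tau> / 2 * (norm (z - z'))\<^sup>2)"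

definition psca_iterates ::
  "('n::finite \<Rightarrow> 'a::euclidean_space set) \<Rightarrow> ('n \<Rightarrow> 'a \<Rightarrow> 'a ^ 'n \<Rightarrow> real) \<Rightarrow> ('n \<Rightarrow> 'a \<Rightarrow> real) \<Rightarrow>
   real \<Rightarrow> 'a ^ 'n \<Rightarrow> (nat \<Rightarrow> 'n set) \<Rightarrow> (nat \<Rightarrow> 'a ^ 'n) \<Rightarrow> (nat \<Rightarrow> 'a ^ 'n) \<Rightarrow> bool" where
  "psca_iterates Xs ft g \<gamma> x0 S x xhat \<longleftrightarrow>
     x 0 = x0 \<and>
     (\<forall>r i. is_arg_min (\<lambda>z. ft i z (x r) + g i z) (\<lambda>z. z \<in> Xs i) (xhat r $ i)) \<and>
     (\<forall>r i. x (Suc r) $ i =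
        (if i \<in> S r then x r $ i + \<gamma> *\<^sub>R (xhat r $ i - x r $ i) else x r $ i))"

definition iterate_bounds ::
  "('a::euclidean_space ^ 'n::finite \<Rightarrow> 'a ^ 'n) \<Rightarrow> ('n \<Rightarrow> 'a \<Rightarrow> 'a ^ 'n \<Rightarrow> 'a) \<Rightarrow> 'a ^ 'n \<Rightarrow>
   real \<Rightarrow> real \<Rightarrow> real \<Rightarrow> (nat \<Rightarrow> 'a ^ 'n) \<Rightarrow> (nat \<Rightarrow> 'a ^ 'n) \<Rightarrow> bool" where
  "iterate_bounds gradf gradft xopt Q Qhat R x xhat \<longleftrightarrow>
     (\<forall>r. norm (gradf (x r)) \<le> Q \<and>
          (\<forall>i. norm (gradft i (xhat r $ i) (x r)) \<le> Qhat) \<and>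
          norm (x r - xopt) \<le> R)"

definition cyclic_rule :: "nat \<Rightarrow> (nat \<Rightarrow> 'n set) \<Rightarrow> (nat \<Rightarrow> 'n set) \<Rightarrow> bool" where
  "cyclic_rule m T S \<longleftrightarrow>
     disjoint_family_on T {..<m} \<and> (\<Union>l<m. T l) = UNIV \<and> (\<forall>r. \<forall>l<m. S (m * r + l) = T l)"

definition history_algebra ::
  "'w measure \<Rightarrow> (nat \<Rightarrow> 'w \<Rightarrow> 'b::topological_space) \<Rightarrow> nat \<Rightarrow> 'w measure" where
  "history_algebra M x r =
     sigma (space M) {x s -` B \<inter> space M | s B. s \<le> r \<and> B \<in> sets borel}"

text \<open>
  The conditional probabilities \<open>p r j\<close> may depend on the history; deterministic ones are the
  special case of constant functions.
\<close>

definition randomized_rule ::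
  "'w measure \<Rightarrow> (nat \<Rightarrow> 'w \<Rightarrow> 'b::topological_space) \<Rightarrow> (nat \<Rightarrow> 'n::finite \<Rightarrow> 'w \<Rightarrow> real) \<Rightarrow>
   real \<Rightarrow> (nat \<Rightarrow> 'w \<Rightarrow> 'n set) \<Rightarrow> bool" where
  "randomized_rule M x p p_min S \<longleftrightarrow>
     p_min > 0 \<and>
     (\<forall>r. S r \<in> measurable M (count_space UNIV)) \<and>
     (\<forall>r j. AE \<omega> in M.
        real_cond_exp M (history_algebra M x r) (indicator {\<omega> \<in> space M. j \<in> S r \<omega>}) \<omega> = p r j \<omega> \<and>
        p r j \<omega> \<ge> p_min)"

end

theory Submission
  imports Defs
begin

text \<open>
  A step towards the best responses decreases \<open>h\<close> by at least \<open>\<gamma> (\<tau> - \<gamma> Lf)\<close> times the squared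
  distance to the best responses of the updated blocks, and by convexity the gap \<open>h - h xopt\<close> is at
  most a constant times the distance to the best responses. Hence the gap \<open>a\<^sub>r\<close> satisfies
  \<open>\<sigma> a\<^sub>r\<^sub>+\<^sub>1\<^sup>2 \<le> a\<^sub>r - a\<^sub>r\<^sub>+\<^sub>1\<close>, which gives the rate \<open>1/r\<close>. For the randomized rule this is applied to
  \<open>E[h(x\<^sup>r)]\<close>: conditioning on the history brings in the factor \<open>p_min\<close>, and Jensen's inequality passes
  from the expected squared gap to the squared expected gap. For the cyclic rule a whole cycle counts
  as one step; the gap at the end \<open>y\<close> of the cycle is compared with the best responses \<open>b $ i\<close> computed when
  block \<open>i\<close> was updated, which are at distance \<open>(1 - \<gamma>) \<parallel>d $ i\<parallel>\<close> from \<open>y $ i\<close>, where \<open>d $ i\<close> is the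
  direction used.
\<close>

section \<open>First-order conditions for convex functions on a set\<close>

text \<open>The derivative is taken within \<open>A\<close>, so it is tested only along the segment
  from \<open>x\<close> to \<open>y\<close>, which stays in \<open>A\<close>. If the inequality
  failed by \<open>\<delta>\<close>, a short step \<open>t\<close> would put \<open>f\<close> above
  its chord by \<open>t * \<delta>\<close> to first order, with an error of at most half of that,
  against convexity.\<close>

lemma convex_on_above_tangent_within:
  fixes f :: "'b::real_inner \<Rightarrow> real"
  assumes f: "convex_on A f" and deriv: "(f has_derivative (\<lambda>d. G \<bullet> d)) (at x within A)"
    and x: "x \<in> A" and y: "y \<in> A"
  shows "f x + G \<bullet> (y - x) \<le> f y"
proof (rule ccontr)
  define e where "e = y - x"
  define \<delta> where "\<delta> = G \<bullet> e - (f y - f x)"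
  assume "\<not> ?thesis"
  then have \<delta>: "\<delta> > 0" by (simp add: \<delta>_def e_def)
  have e: "norm e > 0"
  proof (rule ccontr)
    assume "\<not> norm e > 0"
    then have "x = y" "e = 0" by (auto simp: e_def)
    with \<delta> show False by (simp add: \<delta>_def)
  qed
  \<comment> \<open>With this tolerance the first-order error at \<open>x + t *\<^sub>R e\<close> is
    at most \<open>t * \<delta> / 2\<close>.\<close>
  have "\<delta> / (2 * norm e) > 0" using \<delta> e by simp
  then obtain d where d: "d > 0"
    "\<And>z. z \<in> A \<Longrightarrow> norm (z - x) < d \<Longrightarrow>
       norm (f z - f x - G \<bullet> (z - x)) \<le> \<delta> / (2 * norm e) * norm (z - x)"
    using deriv unfolding has_derivative_within_alt by blast
  \<comment> \<open>The bound 1 keeps the point on the segment; the other bound keeps it within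
    distance \<open>d\<close> of \<open>x\<close>.\<close>
  define t where "t = min 1 (d / (2 * norm e))"
  have t: "0 < t" "t \<le> 1" "t * norm e < d"
  proof -
    show "0 < t" "t \<le> 1" using d(1) e by (auto simp: t_def)
    have "t * norm e \<le> d / (2 * norm e) * norm e"
      using e by (intro mult_right_mono) (auto simp: t_def)
    then show "t * norm e < d" using d(1) e by simp
  qed
  define z where "z = x + t *\<^sub>R e"
  have z': "z = (1 - t) *\<^sub>R x + t *\<^sub>R y" by (simp add: z_def e_def algebra_simps)
  have "z \<in> A" unfolding z'
    using convex_on_imp_convex[OF f] x y t by (intro convexD) auto
  have "norm (f z - f x - G \<bullet> (z - x)) \<le> \<delta> / (2 * norm e) * norm (z - x)"
    using d(2)[OF \<open>z \<in> A\<close>] t by (simp add: z_def)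
  then have "\<bar>f z - f x - t * (G \<bullet> e)\<bar> \<le> t * \<delta> / 2"
    using t e by (simp add: z_def mult.commute)
  moreover have "f z \<le> f x + t * (f y - f x)"
    unfolding z' using convex_onD[OF f, of t x y] x y t by (simp add: algebra_simps)
  moreover have "t * \<delta> = t * (G \<bullet> e) - t * (f y - f x)"
    by (simp add: \<delta>_def right_diff_distrib)
  ultimately have "t * \<delta> \<le> t * \<delta> / 2" by linarith
  then show False using t \<delta> by simp
qed

text \<open>Minimality of \<open>a\<close> is tested at points \<open>w n\<close> that approach
  \<open>a\<close> from \<open>z\<close>. The tangent is taken at \<open>w n\<close> and evaluated
  at \<open>a\<close>; after division by \<open>t n\<close> the claim holds with
  \<open>grad (w n)\<close>, and continuity of \<open>grad\<close> gives the limit.\<close>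

lemma is_arg_min_variational_inequality:
  fixes \<phi> \<psi> :: "'b::real_inner \<Rightarrow> real"
  assumes \<psi>: "convex_on A \<psi>"
    and tangent: "\<And>z z'. z \<in> A \<Longrightarrow> z' \<in> A \<Longrightarrow> \<phi> z' + grad z' \<bullet> (z - z') \<le> \<phi> z"
    and cont: "continuous_on A grad"
    and a: "is_arg_min (\<lambda>z. \<phi> z + \<psi> z) (\<lambda>z. z \<in> A) a" and z: "z \<in> A"
  shows "0 \<le> grad a \<bullet> (z - a) + (\<psi> z - \<psi> a)"
proof -
  have aA: "a \<in> A" and min: "\<And>w. w \<in> A \<Longrightarrow> \<phi> a + \<psi> a \<le> \<phi> w + \<psi> w"
    using a by (auto simp: is_arg_min_linorder)
  define t where "t n = inverse (real (Suc n))" for n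
  define w where "w n = a + t n *\<^sub>R (z - a)" for n
  have t: "0 < t n" "t n \<le> 1" for n by (auto simp: t_def field_simps)
  have w': "w n = (1 - t n) *\<^sub>R a + t n *\<^sub>R z" for n by (simp add: w_def algebra_simps)
  have wA: "w n \<in> A" for n
    unfolding w' using convex_on_imp_convex[OF \<psi>] aA z t[of n] by (intro convexD) auto
  have "w \<longlonglongrightarrow> a + 0 *\<^sub>R (z - a)"
    unfolding w_def t_def by (intro tendsto_intros LIMSEQ_inverse_real_of_nat)
  then have "(\<lambda>n. grad (w n)) \<longlonglongrightarrow> grad a"
    using wA aA by (intro continuous_on_tendsto_compose[OF cont]) auto
  then have "(\<lambda>n. grad (w n) \<bullet> (z - a)) \<longlonglongrightarrow> grad a \<bullet> (z - a)"
    by (intro tendsto_intros)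
  moreover have "\<psi> a - \<psi> z \<le> grad (w n) \<bullet> (z - a)" for n
  proof -
    have "\<phi> (w n) + grad (w n) \<bullet> (a - w n) \<le> \<phi> a" using tangent aA wA by blast
    moreover have "\<phi> a + \<psi> a \<le> \<phi> (w n) + \<psi> (w n)" using min wA by blast
    moreover have "\<psi> (w n) \<le> (1 - t n) * \<psi> a + t n * \<psi> z"
      unfolding w' using convex_onD[OF \<psi>, of "t n" a z] aA z t[of n] by auto
    moreover have "grad (w n) \<bullet> (a - w n) = - (t n * (grad (w n) \<bullet> (z - a)))"
      by (simp add: w_def)
    ultimately have "t n * (\<psi> a - \<psi> z) \<le> t n * (grad (w n) \<bullet> (z - a))"
      by (simp add: algebra_simps)
    then show ?thesis using t[of n] by simp
  qed
  ultimately have "\<psi> a - \<psi> z \<le> grad a \<bullet> (z - a)"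
    by (intro LIMSEQ_le_const) auto
  then show ?thesis by simp
qed

section \<open>From the quadratic recursion to the rate\<close>

text \<open>For \<open>u = \<sigma> * a\<close> the recursion reads
  \<open>u (Suc r) + (u (Suc r))\<^sup>2 \<le> u r\<close>. Since \<open>v + v\<^sup>2\<close>
  increases on nonnegative reals, \<open>u r \<le> c / r\<close> follows by induction from a
  comparison with the sequence \<open>c / r\<close> itself.\<close>

lemma quadratic_recursion_rate:
  fixes a :: "nat \<Rightarrow> real"
  assumes \<sigma>: "\<sigma> > 0" and nonneg: "\<And>r. 0 \<le> a r"
    and step: "\<And>r. \<sigma> * (a (Suc r))\<^sup>2 \<le> a r - a (Suc r)" and r: "r \<ge> 1"
  shows "a r \<le> Max {4 * \<sigma> - 2, a 0, 2} / \<sigma> * (1 / real r)"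
proof -
  define c where "c = Max {4 * \<sigma> - 2, a 0, 2}"
  have c: "4 * \<sigma> - 2 \<le> c" "a 0 \<le> c" "2 \<le> c" by (auto simp: c_def)
  define u where "u r = \<sigma> * a r" for r
  have u0: "0 \<le> u r" for r using \<sigma> nonneg by (simp add: u_def)
  have us: "u (Suc r) + (u (Suc r))\<^sup>2 \<le> u r" for r
    using mult_left_mono[OF step[of r], of \<sigma>] \<sigma>
    by (simp add: u_def power2_eq_square algebra_simps)
  have below: "v \<le> w" if "v + v\<^sup>2 \<le> w + w\<^sup>2" "0 \<le> v" "0 \<le> w" for v w :: real
  proof (rule ccontr)
    assume "\<not> v \<le> w"
    then have "w\<^sup>2 \<le> v\<^sup>2" using that by (intro power_mono) auto
    with \<open>\<not> v \<le> w\<close> that show False by linarith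
  qed
  have "u r \<le> c / real r"
    using r
  proof (induction r rule: dec_induct)
    case base
    have "u 1 + (u 1)\<^sup>2 \<le> \<sigma> * a 0" using us[of 0] by (simp add: u_def)
    also have "\<dots> \<le> \<sigma> * c" using \<sigma> c by simp
    \<comment> \<open>The entry \<open>4 * \<sigma> - 2\<close> of the maximum serves here: it says
      \<open>\<sigma> \<le> (c + 2) / 4\<close>.\<close>
    also have "\<dots> \<le> (c + 2) / 4 * c" using c by (intro mult_right_mono) auto
    also have "\<dots> \<le> c + c\<^sup>2"
      using c by (simp add: power2_eq_square algebra_simps)
    finally have "u 1 \<le> c" using below[of "u 1" c] u0[of 1] c by auto
    then show ?case by simp
  next
    case (step k)
    have k: "real k \<ge> 1" using step by simp
    have "c / real k = c / (real k + 1) + c / (real k * (real k + 1))"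
    proof -
      have "c / real k - c / (real k + 1) = (c * (real k + 1) - c * k) / (real k * (real k + 1))"
        using k by (intro diff_frac_eq) auto
      then show ?thesis by (simp add: distrib_left)
    qed
    also have "c / (real k * (real k + 1)) \<le> (c / (real k + 1))\<^sup>2"
    proof -
      \<comment> \<open>The entry 2 of the maximum serves here:
        \<open>k + 1 \<le> 2 * k \<le> c * k\<close> for \<open>k \<ge> 1\<close>.\<close>
      have "real k + 1 \<le> c * real k" using mult_right_mono[OF c(3), of "real k"] k by linarith
      then have "1 / real k \<le> c / (real k + 1)"
        using k by (simp add: pos_divide_le_eq pos_le_divide_eq)
      then have "c / (real k + 1) * (1 / real k) \<le> c / (real k + 1) * (c / (real k + 1))"
        using c by (intro mult_left_mono) auto
      then show ?thesis by (simp add: power2_eq_square mult.commute)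
    qed
    finally have "u (Suc k) + (u (Suc k))\<^sup>2 \<le> c / (real k + 1) + (c / (real k + 1))\<^sup>2"
      using us[of k] step.IH by linarith
    then have "u (Suc k) \<le> c / (real k + 1)" 
      using below[of "u (Suc k)" "c / (real k + 1)"] u0[of "Suc k"] c by auto
    then show ?case by (simp add: add.commute)
  qed
  then have "a r \<le> c / \<sigma> * (1 / real r)"
    using \<sigma> r by (simp add: u_def field_simps)
  then show ?thesis by (simp only: c_def)
qed

section \<open>Block norms and bounds on expectations\<close>

lemma norm_vec_sq: "(norm (v :: 'b::real_inner ^ 'n::finite))\<^sup>2 = (\<Sum>i\<in>UNIV. (norm (v $ i))\<^sup>2)"
  by (simp add: power2_norm_eq_inner inner_vec_def)

text \<open>Cauchy-Schwarz against the all-ones vector.\<close>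

lemma sum_norm_le_sqrt_card:
  "(\<Sum>i\<in>UNIV. norm (v $ i)) \<le> sqrt (real CARD('n)) * norm (v :: 'b::real_inner ^ 'n::finite)"
proof -
  have "(\<Sum>i\<in>UNIV. \<bar>1::real\<bar> * \<bar>norm (v $ i)\<bar>) \<le> L2_set (\<lambda>i::'n. 1::real) UNIV * L2_set (\<lambda>i. norm (v $ i)) UNIV"
    by (rule L2_set_mult_ineq)
  then show ?thesis by (simp add: L2_set_def norm_vec_def)
qed

lemma sum_norm_mult_le:
  "(\<Sum>i\<in>UNIV. norm (v $ i) * norm (w $ i))
     \<le> norm (v :: 'b::real_inner ^ 'n::finite) * norm (w :: 'c::real_inner ^ 'n)"
  using L2_set_mult_ineq[of "\<lambda>i. norm (v $ i)" "\<lambda>i. norm (w $ i)" "UNIV :: 'n set"]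
  by (simp add: norm_vec_def)

text \<open>Since \<open>\<phi>\<close> is measurable for \<open>F\<close>, the indicator of
  \<open>A\<close> may be replaced under the expectation by its conditional probability, which is at
  least \<open>c\<close>. Here \<open>A\<close> will be the selection of a block and
  \<open>F\<close> the history.\<close>

lemma (in prob_space) cond_prob_lower_bound:
  assumes sub: "subalgebra M F" and A: "A \<in> events"
    and c: "AE \<omega> in M. c \<le> real_cond_exp M F (indicator A) \<omega>"
    and \<phi>: "\<phi> \<in> borel_measurable F" "\<And>\<omega>. 0 \<le> \<phi> \<omega>" "integrable M \<phi>"
  shows "c * expectation \<phi> \<le> expectation (\<lambda>\<omega>. \<phi> \<omega> * indicator A \<omega>)"
proof -
  interpret finite_measure_subalgebra M F by unfold_locales (rule sub)
  have int: "integrable M (\<lambda>\<omega>. \<phi> \<omega> * indicator A \<omega>)"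
    using \<phi>(3) A by (rule integrable_real_mult_indicator[rotated])
  note E = real_cond_exp_intg[OF int \<phi>(1) borel_measurable_indicator[OF A]]
  have "c * expectation \<phi> = expectation (\<lambda>\<omega>. \<phi> \<omega> * c)" by simp
  also have "\<dots> \<le> expectation (\<lambda>\<omega>. \<phi> \<omega> * real_cond_exp M F (indicator A) \<omega>)"
    using c \<phi> E(1) by (intro integral_mono_AE) (auto intro!: mult_left_mono)
  finally show ?thesis using E(2) by simp
qed

lemma (in finite_measure) integrable_simple_function:
  fixes u :: "'a \<Rightarrow> real"
  assumes "simple_function M u"
  shows "integrable M u"
  using assms
  by (intro integrableI_simple_bochner_integrable simple_bochner_integrable.intros)
    (auto simp: emeasure_eq_measure)


text \<open>The variance is nonnegative.\<close>

lemma (in prob_space) expectation_power2_le: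
  fixes u :: "'a \<Rightarrow> real"
  assumes "integrable M u" "integrable M (\<lambda>\<omega>. (u \<omega>)\<^sup>2)"
  shows "(expectation u)\<^sup>2 \<le> expectation (\<lambda>\<omega>. (u \<omega>)\<^sup>2)"
  using variance_eq[OF assms] variance_positive[of u] by simp

lemma power2_sum_le: "(a + b)\<^sup>2 \<le> 2 * (a\<^sup>2 + b\<^sup>2)" for a b :: real
proof -
  have "0 \<le> (a - b)\<^sup>2" by simp
  then show ?thesis by (simp add: power2_eq_square algebra_simps)
qed

section \<open>The problem data and its best responses\<close>

text \<open>One step as a function of the point, the responses and the selected set, so that both
  rules share its analysis and the random iterates can be written as functions of the
  selections.\<close>

definition relaxed_update ::
  "real \<Rightarrow> 'a::real_vector ^ 'n::finite \<Rightarrow> 'a ^ 'n \<Rightarrow> 'n set \<Rightarrow> 'a ^ 'n" where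
  "relaxed_update \<gamma> y b I = (\<chi> i. if i \<in> I then y $ i + \<gamma> *\<^sub>R (b $ i - y $ i) else y $ i)"

text \<open>The analytic hypotheses common to both selection rules, with one constant
  \<open>L\<close> for all blocks.\<close>

locale psca_problem =
  fixes Xs :: "'n::finite \<Rightarrow> 'a::euclidean_space set"
    and f :: "'a ^ 'n \<Rightarrow> real" and gradf :: "'a ^ 'n \<Rightarrow> 'a ^ 'n"
    and g :: "'n \<Rightarrow> 'a \<Rightarrow> real"
    and ft :: "'n \<Rightarrow> 'a \<Rightarrow> 'a ^ 'n \<Rightarrow> real" and gradft :: "'n \<Rightarrow> 'a \<Rightarrow> 'a ^ 'n \<Rightarrow> 'a"
    and Lf Lt Lg L \<tau> \<gamma> :: real and xopt :: "'a ^ 'n"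
  assumes f_diff: "cont_diff_on (block_prod Xs) f gradf"
    and f_convex: "convex_on (block_prod Xs) f"
    and g_convex: "\<And>i. convex_on (Xs i) (g i)"
    and gradf_lipschitz: "lipschitz_on Lf (block_prod Xs) gradf"
    and \<tau>_pos: "\<tau> > 0"
    and ft_strong: "\<And>i y. y \<in> block_prod Xs \<Longrightarrow>
      strongly_convex_on \<tau> (Xs i) (\<lambda>z. ft i z y) (\<lambda>z. gradft i z y)"
    and ft_consistent: "\<And>i y. y \<in> block_prod Xs \<Longrightarrow> gradft i (y $ i) y = gradf y $ i"
    and gradft_lipschitz2: "\<And>i z. z \<in> Xs i \<Longrightarrow> lipschitz_on Lt (block_prod Xs) (\<lambda>y. gradft i z y)"
    and gradft_lipschitz1: "\<And>i y. y \<in> block_prod Xs \<Longrightarrow> lipschitz_on L (Xs i) (\<lambda>z. gradft i z y)"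
    and g_lipschitz: "lipschitz_on Lg (block_prod Xs) (block_sum g)"
    and step_size: "0 < \<gamma>" "\<gamma> \<le> 1" "\<gamma> * Lf < \<tau>"
    and xopt: "is_arg_min (objective f g) (\<lambda>y. y \<in> block_prod Xs) xopt"
begin

abbreviation X :: "('a ^ 'n) set" where "X \<equiv> block_prod Xs"
abbreviation h :: "'a ^ 'n \<Rightarrow> real" where "h \<equiv> objective f g"

definition best_response :: "'a ^ 'n \<Rightarrow> 'n \<Rightarrow> 'a \<Rightarrow> bool" where
  "best_response y i b \<longleftrightarrow> is_arg_min (\<lambda>z. ft i z y + g i z) (\<lambda>z. z \<in> Xs i) b"

lemma block_in: "y \<in> X \<Longrightarrow> y $ i \<in> Xs i"
  by (simp add: block_prod_def)

lemma xopt_in: "xopt \<in> X" and xopt_le: "y \<in> X \<Longrightarrow> h xopt \<le> h y"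
  using xopt by (auto simp: is_arg_min_linorder)

lemma Lipschitz_nonneg: "0 \<le> Lf" "0 \<le> Lt" "0 \<le> Lg" "0 \<le> L"
  using gradf_lipschitz gradft_lipschitz1[OF xopt_in] gradft_lipschitz2[OF block_in[OF xopt_in]]
    g_lipschitz by (auto dest: lipschitz_on_nonneg)

lemma rate_pos: "0 < \<gamma> * (\<tau> - \<gamma> * Lf)"
  using step_size by simp

lemma best_response_in: "best_response y i b \<Longrightarrow> b \<in> Xs i"
  by (simp add: best_response_def is_arg_min_def)

lemma f_tangent:
  assumes "y \<in> X" "z \<in> X"
  shows "f y + gradf y \<bullet> (z - y) \<le> f z"
  using f_diff assms by (intro convex_on_above_tangent_within[OF f_convex]) (auto simp: cont_diff_on_def)

text \<open>Sum of the strong convexity inequalities for \<open>z, z'\<close> and for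
  \<open>z', z\<close>; the function values cancel.\<close>

lemma gradft_strongly_monotone:
  assumes "y \<in> X" "z \<in> Xs i" "z' \<in> Xs i"
  shows "\<tau> * (norm (z - z'))\<^sup>2 \<le> (gradft i z y - gradft i z' y) \<bullet> (z - z')"
proof -
  have "ft i z' y + gradft i z' y \<bullet> (z - z') + \<tau> / 2 * (norm (z - z'))\<^sup>2 \<le> ft i z y"
    and "ft i z y + gradft i z y \<bullet> (z' - z) + \<tau> / 2 * (norm (z' - z))\<^sup>2 \<le> ft i z' y"
    using ft_strong[OF assms(1), of i] assms by (auto simp: strongly_convex_on_def)
  then show ?thesis by (simp add: norm_minus_commute inner_diff_left inner_diff_right)
qed

text \<open>Optimality condition of the block subproblem; the nonsmooth \<open>g i\<close> enters by
  a difference of values instead of a subgradient.\<close>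

lemma best_response_variational:
  assumes y: "y \<in> X" and b: "best_response y i b" and z: "z \<in> Xs i"
  shows "0 \<le> gradft i b y \<bullet> (z - b) + (g i z - g i b)"
proof (rule is_arg_min_variational_inequality[where \<phi> = "\<lambda>z. ft i z y" and grad = "\<lambda>z. gradft i z y"])
  show "continuous_on (Xs i) (\<lambda>z. gradft i z y)"
    using gradft_lipschitz1[OF y] by (rule lipschitz_on_continuous_on)
  show "ft i z' y + gradft i z' y \<bullet> (z - z') \<le> ft i z y" if "z \<in> Xs i" "z' \<in> Xs i" for z z'
  proof -
    have "ft i z' y + gradft i z' y \<bullet> (z - z') + \<tau> / 2 * (norm (z - z'))\<^sup>2 \<le> ft i z y"
      using ft_strong[OF y, of i] that by (auto simp: strongly_convex_on_def)
    moreover have "0 \<le> \<tau> / 2 * (norm (z - z'))\<^sup>2" using \<tau>_pos by simp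
    ultimately show ?thesis by linarith
  qed
qed (use g_convex b z in \<open>auto simp: best_response_def\<close>)

text \<open>Each response is tested in the variational inequality of the other. In the sum the
  values of \<open>g i\<close> cancel, and strong monotonicity leaves no distance. Uniqueness makes
  the responses a function of the current point.\<close>

lemma best_response_unique:
  assumes y: "y \<in> X" and b: "best_response y i b" and c: "best_response y i c"
  shows "b = c"
proof -
  note mem = best_response_in[OF b] best_response_in[OF c]
  have "\<tau> * (norm (b - c))\<^sup>2 \<le> 0"
    using best_response_variational[OF y b mem(2)] best_response_variational[OF y c mem(1)]
      gradft_strongly_monotone[OF y mem]
    by (simp add: inner_diff_left inner_diff_right)
  then have "(norm (b - c))\<^sup>2 \<le> 0" using \<tau>_pos by (simp add: mult_le_0_iff)
  then show ?thesis by simp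
qed

section \<open>Feasibility, decrease and optimality gap\<close>

lemma relaxed_update_in:
  assumes "y \<in> X" "\<And>i. best_response y i (b $ i)"
  shows "relaxed_update \<gamma> y b I \<in> X"
proof -
  have "y $ i + \<gamma> *\<^sub>R (b $ i - y $ i) \<in> Xs i" for i
  proof -
    have "(1 - \<gamma>) *\<^sub>R (y $ i) + \<gamma> *\<^sub>R (b $ i) \<in> Xs i"
      using convex_on_imp_convex[OF g_convex] block_in[OF assms(1)] best_response_in[OF assms(2)] step_size
      by (intro convexD) auto
    then show ?thesis by (simp add: algebra_simps)
  qed
  then show ?thesis using block_in[OF assms(1)] by (auto simp: block_prod_def relaxed_update_def)
qed

text \<open>The gradient inequality for \<open>f\<close> is taken at the new point; together with the Lipschitz
  bound this replaces the descent lemma.\<close>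

lemma sufficient_decrease:
  assumes y: "y \<in> X" and b: "\<And>i. best_response y i (b $ i)"
  shows "h (relaxed_update \<gamma> y b I)
    \<le> h y - \<gamma> * (\<tau> - \<gamma> * Lf) * (\<Sum>i\<in>I. (norm (b $ i - y $ i))\<^sup>2)"
proof -
  \<comment> \<open>The step actually taken, with zero in the blocks that stay, so that sums over
    \<open>I\<close> become inner products and norms of full vectors.\<close>
  define d where "d = (\<chi> i. if i \<in> I then b $ i - y $ i else 0)"
  define y' where "y' = relaxed_update \<gamma> y b I"
  have y'X: "y' \<in> X" unfolding y'_def by (rule relaxed_update_in[OF y b])
  have y': "y' = y + \<gamma> *\<^sub>R d"
    by (simp add: y'_def relaxed_update_def d_def vec_eq_iff)
  have sum_I: "(\<Sum>i\<in>UNIV. if i \<in> I then u i else 0) = sum u I" for u :: "'n \<Rightarrow> real"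
    by (simp add: sum.If_cases)
  have "(norm d)\<^sup>2 = (\<Sum>i\<in>UNIV. if i \<in> I then (norm (b $ i - y $ i))\<^sup>2 else 0)"
    unfolding norm_vec_sq by (intro sum.cong) (auto simp: d_def)
  then have norm_d: "(norm d)\<^sup>2 = (\<Sum>i\<in>I. (norm (b $ i - y $ i))\<^sup>2)" by (simp only: sum_I)
  have "gradf y \<bullet> d = (\<Sum>i\<in>UNIV. if i \<in> I then gradf y $ i \<bullet> (b $ i - y $ i) else 0)"
    unfolding inner_vec_def by (intro sum.cong) (auto simp: d_def)
  then have grad_d: "gradf y \<bullet> d = (\<Sum>i\<in>I. gradf y $ i \<bullet> (b $ i - y $ i))" by (simp only: sum_I)

  have "(gradf y' - gradf y) \<bullet> d \<le> norm (gradf y' - gradf y) * norm d"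
    by (rule norm_cauchy_schwarz)
  also have "\<dots> \<le> Lf * norm (y' - y) * norm d"
    using lipschitz_onD[OF gradf_lipschitz y'X y] by (intro mult_right_mono) (auto simp: dist_norm)
  also have "\<dots> = \<gamma> * Lf * (norm d)\<^sup>2"
    using step_size by (simp add: y' power2_eq_square)
  finally have curvature: "\<gamma> * ((gradf y' - gradf y) \<bullet> d) \<le> \<gamma> * (\<gamma> * Lf * (norm d)\<^sup>2)"
    using step_size by simp
  have "f y' \<le> f y + \<gamma> * (gradf y' \<bullet> d)"
    using f_tangent[OF y'X y] by (simp add: y')
  then have f_le: "f y' \<le> f y + \<gamma> * (gradf y \<bullet> d) + \<gamma> * (\<gamma> * Lf * (norm d)\<^sup>2)"
    using curvature by (simp add: inner_diff_left right_diff_distrib)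

  have "g i (y' $ i) \<le> g i (y $ i) + (if i \<in> I then \<gamma> * (g i (b $ i) - g i (y $ i)) else 0)" for i
  proof (cases "i \<in> I")
    case True
    then have "y' $ i = (1 - \<gamma>) *\<^sub>R y $ i + \<gamma> *\<^sub>R b $ i"
      by (simp add: y'_def relaxed_update_def algebra_simps)
    then have "g i (y' $ i) \<le> (1 - \<gamma>) * g i (y $ i) + \<gamma> * g i (b $ i)"
      using convex_onD[OF g_convex, of \<gamma> "y $ i" i "b $ i"] step_size block_in[OF y]
        best_response_in[OF b] by simp
    then show ?thesis using True by (simp add: algebra_simps)
  qed (simp add: y'_def relaxed_update_def)
  then have "block_sum g y' \<le> (\<Sum>i\<in>UNIV. g i (y $ i)
      + (if i \<in> I then \<gamma> * (g i (b $ i) - g i (y $ i)) else 0))"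
    unfolding block_sum_def by (intro sum_mono)
  then have g_le: "block_sum g y' \<le> block_sum g y + \<gamma> * (\<Sum>i\<in>I. g i (b $ i) - g i (y $ i))"
    by (simp only: sum.distrib sum_I block_sum_def sum_distrib_left)

  \<comment> \<open>The optimality condition of \<open>b $ i\<close> is tested at the current block
    \<open>y $ i\<close>; strong monotonicity then moves the gradient from \<open>b $ i\<close> to
    \<open>y $ i\<close>, where it agrees with that of \<open>f\<close>.\<close>
  have "gradf y $ i \<bullet> (b $ i - y $ i) + (g i (b $ i) - g i (y $ i))
      \<le> - (\<tau> * (norm (b $ i - y $ i))\<^sup>2)" for i
    using best_response_variational[OF y b block_in[OF y], of i]
      gradft_strongly_monotone[OF y best_response_in[OF b] block_in[OF y], of i]
    by (simp add: ft_consistent[OF y] inner_diff_left inner_diff_right)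
  then have "(\<Sum>i\<in>I. gradf y $ i \<bullet> (b $ i - y $ i) + (g i (b $ i) - g i (y $ i)))
      \<le> (\<Sum>i\<in>I. - (\<tau> * (norm (b $ i - y $ i))\<^sup>2))"
    by (intro sum_mono)
  then have "gradf y \<bullet> d + (\<Sum>i\<in>I. g i (b $ i) - g i (y $ i)) \<le> - (\<tau> * (norm d)\<^sup>2)"
    by (simp only: sum.distrib grad_d norm_d sum_negf sum_distrib_left)
  then have "\<gamma> * (gradf y \<bullet> d) + \<gamma> * (\<Sum>i\<in>I. g i (b $ i) - g i (y $ i)) \<le> \<gamma> * - (\<tau> * (norm d)\<^sup>2)"
    using step_size by (simp only: distrib_left[symmetric]) (intro mult_left_mono, auto)
  then have "h y' \<le> h y - \<gamma> * (\<tau> - \<gamma> * Lf) * (norm d)\<^sup>2"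
    using f_le g_le by (simp add: objective_def algebra_simps)
  then show ?thesis by (simp add: y'_def norm_d)
qed

lemma block_sum_diff_le:
  assumes "y \<in> X" "z \<in> X"
  shows "block_sum g y - block_sum g z \<le> Lg * norm (y - z)"
  using lipschitz_onD[OF g_lipschitz assms] by (simp add: dist_norm)

text \<open>The optimality condition produces \<open>b $ i - xopt $ i\<close>, which is not controlled by \<open>R\<close>. By strong
  monotonicity the part \<open>b $ i - y $ i\<close> has the right sign, so only \<open>y - xopt\<close> enters.\<close>

lemma optimality_gap_le:
  assumes y: "y \<in> X" and b: "\<And>i. best_response y i (b $ i)"
  shows "h y - h xopt \<le> (norm (gradf y) + Lg + L * norm (y - xopt)) * norm (b - y)"
proof -
  have bX: "b \<in> X" using best_response_in[OF b] by (simp add: block_prod_def)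
  have block: "gradf y $ i \<bullet> (y $ i - xopt $ i) + (g i (b $ i) - g i (xopt $ i))
      \<le> gradf y $ i \<bullet> (y $ i - b $ i) + L * (norm (b $ i - y $ i) * norm (y $ i - xopt $ i))" for i
  proof -
    let ?u = "gradf y $ i" and ?v = "gradft i (b $ i) y"
    have "0 \<le> \<tau> * (norm (b $ i - y $ i))\<^sup>2" using \<tau>_pos by simp
    also have "\<dots> \<le> (?v - ?u) \<bullet> (b $ i - y $ i)"
      using gradft_strongly_monotone[OF y best_response_in[OF b] block_in[OF y], of i]
      by (simp add: ft_consistent[OF y])
    finally have mono: "0 \<le> (?v - ?u) \<bullet> (b $ i - y $ i)" .
    have "(?u - ?v) \<bullet> (y $ i - xopt $ i) \<le> norm (?u - ?v) * norm (y $ i - xopt $ i)"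
      by (rule norm_cauchy_schwarz)
    also have "norm (?u - ?v) \<le> L * norm (b $ i - y $ i)"
      using lipschitz_onD[OF gradft_lipschitz1[OF y] block_in[OF y] best_response_in[OF b], of i]
      by (simp add: dist_norm ft_consistent[OF y] norm_minus_commute)
    finally have "(?u - ?v) \<bullet> (y $ i - xopt $ i) \<le> L * (norm (b $ i - y $ i) * norm (y $ i - xopt $ i))"
      by (simp add: mult_right_mono mult.assoc)
    \<comment> \<open>After the optimality condition is used, the left side is at most
      \<open>?u \<bullet> (y - xopt) + ?v \<bullet> (xopt - b)\<close> in block \<open>i\<close>.
      This equals \<open>(?u - ?v) \<bullet> (y - xopt) + ?u \<bullet> (y - b) - (?v - ?u) \<bullet>
      (b - y)\<close>, and \<open>mono\<close> discards the last term.\<close>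
    with mono best_response_variational[OF y b block_in[OF xopt_in], of i] show ?thesis
      by (simp add: inner_diff_left inner_diff_right)
  qed
  have "gradf y \<bullet> (y - xopt) + (block_sum g b - block_sum g xopt)
      = (\<Sum>i\<in>UNIV. gradf y $ i \<bullet> (y $ i - xopt $ i) + (g i (b $ i) - g i (xopt $ i)))"
    by (simp add: inner_vec_def block_sum_def sum.distrib sum_subtractf)
  also have "\<dots> \<le> (\<Sum>i\<in>UNIV. gradf y $ i \<bullet> (y $ i - b $ i)
      + L * (norm (b $ i - y $ i) * norm (y $ i - xopt $ i)))"
    by (intro sum_mono block)
  also have "\<dots> = gradf y \<bullet> (y - b) + L * (\<Sum>i\<in>UNIV. norm ((b - y) $ i) * norm ((y - xopt) $ i))"
    by (simp add: inner_vec_def sum.distrib sum_distrib_left)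
  also have "\<dots> \<le> norm (gradf y) * norm (y - b) + L * (norm (b - y) * norm (y - xopt))"
    using Lipschitz_nonneg by (intro add_mono norm_cauchy_schwarz mult_left_mono sum_norm_mult_le)
  finally have "gradf y \<bullet> (y - xopt) + (block_sum g b - block_sum g xopt)
      \<le> norm (gradf y) * norm (b - y) + L * (norm (b - y) * norm (y - xopt))"
    by (simp add: norm_minus_commute)
  moreover have "f y - f xopt \<le> gradf y \<bullet> (y - xopt)"
    using f_tangent[OF y xopt_in] by (simp add: inner_diff_right)
  \<comment> \<open>The Lipschitz hypothesis concerns \<open>block_sum g\<close> as a whole, so the
    exchange of \<open>b\<close> for \<open>y\<close> in \<open>g\<close> is made after summation
    over the blocks.\<close>
  moreover have "block_sum g y - block_sum g b \<le> Lg * norm (b - y)"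
    using block_sum_diff_le[OF y bX] by (simp add: norm_minus_commute)
  ultimately show ?thesis by (simp add: objective_def algebra_simps)
qed

text \<open>Within a cycle the responses \<open>b $ i\<close> belong to different earlier points
  \<open>w i\<close>. The gradient error is split into a change of the second argument from
  \<open>y\<close> to \<open>w i\<close>, which costs \<open>Lt\<close>, and a change of the first
  from \<open>y $ i\<close> to \<open>b $ i\<close>, which costs \<open>L\<close>.\<close>

lemma optimality_gap_delayed_le:
  assumes y: "y \<in> X" and w: "\<And>i. w i \<in> X" and b: "\<And>i. best_response (w i) i (b $ i)"
  shows "h y - h xopt \<le> Lg * norm (y - b)
    + (\<Sum>i\<in>UNIV. (Lt * norm (y - w i) + L * norm ((y - b) $ i)) * norm ((y - xopt) $ i)
        + norm (gradft i (b $ i) (w i)) * norm ((y - b) $ i))"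
proof -
  have bX: "b \<in> X" using best_response_in[OF b] by (simp add: block_prod_def)
  have block: "gradf y $ i \<bullet> (y $ i - xopt $ i) + (g i (b $ i) - g i (xopt $ i))
      \<le> (Lt * norm (y - w i) + L * norm ((y - b) $ i)) * norm ((y - xopt) $ i)
        + norm (gradft i (b $ i) (w i)) * norm ((y - b) $ i)" for i
  proof -
    \<comment> \<open>By consistency \<open>?u\<close> is \<open>gradft i (y $ i) y\<close>;
      \<open>?c\<close> differs from it only in the second argument and from \<open>?v\<close> only
      in the first.\<close>
    let ?u = "gradf y $ i" and ?v = "gradft i (b $ i) (w i)" and ?c = "gradft i (y $ i) (w i)"
    have "norm (?u - ?v) \<le> norm (?u - ?c) + norm (?c - ?v)" 
      using norm_triangle_ineq[of "?u - ?c" "?c - ?v"] by simp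
    also have "norm (?u - ?c) \<le> Lt * norm (y - w i)"
      using lipschitz_onD[OF gradft_lipschitz2[OF block_in[OF y]] y w, of i i]
      by (simp add: dist_norm ft_consistent[OF y])
    also have "norm (?c - ?v) \<le> L * norm ((y - b) $ i)"
      using lipschitz_onD[OF gradft_lipschitz1[OF w] block_in[OF y] best_response_in[OF b], of i i]
      by (simp add: dist_norm)
    finally have "norm (?u - ?v) \<le> Lt * norm (y - w i) + L * norm ((y - b) $ i)" by simp
    then have "(?u - ?v) \<bullet> (y $ i - xopt $ i)
        \<le> (Lt * norm (y - w i) + L * norm ((y - b) $ i)) * norm ((y - xopt) $ i)"
      using norm_cauchy_schwarz[of "?u - ?v" "y $ i - xopt $ i"]
      by (simp, meson mult_right_mono norm_ge_zero order_trans)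
    moreover have "?v \<bullet> (y $ i - b $ i) \<le> norm ?v * norm ((y - b) $ i)"
      by (simp add: norm_cauchy_schwarz)
    \<comment> \<open>The sum \<open>?u \<bullet> (y - xopt) + ?v \<bullet> (xopt - b)\<close> is
      regrouped in block \<open>i\<close> as
      \<open>(?u - ?v) \<bullet> (y - xopt) + ?v \<bullet> (y - b)\<close>.\<close>
    ultimately show ?thesis
      using best_response_variational[OF w b block_in[OF xopt_in], of i]
      by (simp add: inner_diff_left inner_diff_right)
  qed
  have "gradf y \<bullet> (y - xopt) + (block_sum g b - block_sum g xopt)
      = (\<Sum>i\<in>UNIV. gradf y $ i \<bullet> (y $ i - xopt $ i) + (g i (b $ i) - g i (xopt $ i)))"
    by (simp add: inner_vec_def block_sum_def sum.distrib sum_subtractf)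
  also have "\<dots> \<le> (\<Sum>i\<in>UNIV. (Lt * norm (y - w i) + L * norm ((y - b) $ i)) * norm ((y - xopt) $ i)
        + norm (gradft i (b $ i) (w i)) * norm ((y - b) $ i))"
    by (intro sum_mono block)
  finally show ?thesis
    using f_tangent[OF y xopt_in] block_sum_diff_le[OF y bX]
    by (simp add: objective_def inner_diff_right)
qed

section \<open>The iteration and the cyclic rule\<close>

lemma psca_iterates_iff:
  "psca_iterates Xs ft g \<gamma> x0 S x xhat \<longleftrightarrow>
     x 0 = x0 \<and> (\<forall>r i. best_response (x r) i (xhat r $ i)) \<and>
     (\<forall>r. x (Suc r) = relaxed_update \<gamma> (x r) (xhat r) (S r))"
  by (simp add: psca_iterates_def best_response_def relaxed_update_def vec_eq_iff)

lemma psca_iterates_in: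
  assumes "psca_iterates Xs ft g \<gamma> x0 S x xhat" "x0 \<in> X"
  shows "x r \<in> X"
  using assms by (induction r) (auto simp: psca_iterates_iff intro: relaxed_update_in)

theorem cyclic_rate:
  assumes \<gamma>1: "\<gamma> < 1" and cyc: "cyclic_rule m T S"
    and iter: "psca_iterates Xs ft g \<gamma> x0 S x xhat" and x0: "x0 \<in> X"
    and bounds: "iterate_bounds gradf gradft xopt Q Qhat R x xhat" and Qhat: "Qhat > 0"
    and \<theta>_eq: "\<theta> = Lg\<^sup>2 + Qhat\<^sup>2 +
      2 * real CARD('n) * R\<^sup>2 * Lt\<^sup>2 * (\<gamma>\<^sup>2 / (1 - \<gamma>)\<^sup>2) + 2 * R\<^sup>2 * L\<^sup>2"
    and \<sigma>_eq: "\<sigma> = ((\<tau> - \<gamma> * Lf) * \<gamma>) / (6 * real CARD('n) * \<theta> * (1 - \<gamma>)\<^sup>2)"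
    and r: "r \<ge> 1"
  shows "h (x (m * r)) - h xopt \<le> Max {4 * \<sigma> - 2, h x0 - h xopt, 2} / \<sigma> * (1 / real r)"
proof -
  define n where "n = real CARD('n)"
  have n: "n \<ge> 1" by (simp add: n_def Suc_leI)
  have xX: "x k \<in> X" for k using iter x0 by (rule psca_iterates_in)
  have x_0: "x 0 = x0" and br: "\<And>k i. best_response (x k) i (xhat k $ i)"
    and step: "\<And>k. x (Suc k) = relaxed_update \<gamma> (x k) (xhat k) (S k)"
    using iter by (auto simp: psca_iterates_iff)
  have R: "norm (x k - xopt) \<le> R" and Q: "norm (gradft i (xhat k $ i) (x k)) \<le> Qhat" for k i
    using bounds by (auto simp: iterate_bounds_def)
  have R0: "0 \<le> R" using R[of 0] norm_ge_zero order_trans by blast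
  have S: "S (m * k + l) = T l" if "l < m" for k l using cyc that by (auto simp: cyclic_rule_def)
  \<comment> \<open>\<open>l i\<close> is the position in the cycle at which block \<open>i\<close>
    is updated; disjointness makes it unique.\<close>
  have "\<exists>l<m. i \<in> T l" for i using cyc by (auto simp: cyclic_rule_def)
  then obtain l where l: "\<And>i. l i < m" "\<And>i. i \<in> T (l i)" by metis
  have T: "T k = {i. l i = k}" if "k < m" for k
  proof -
    have "l i = k" if "i \<in> T k" for i
      using cyc \<open>k < m\<close> l that unfolding cyclic_rule_def disjoint_family_on_def by blast
    then show ?thesis using l by auto
  qed

  define a where "a k = h (x (m * k)) - h xopt" for k
  have a_nonneg: "0 \<le> a k" for k using xopt_le[OF xX] by (simp add: a_def)
  have \<theta>_pos: "\<theta> > 0"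
    unfolding \<theta>_eq using Qhat by (intro add_pos_nonneg add_nonneg_pos) auto
  have "(1 - \<gamma>)\<^sup>2 > 0" using \<gamma>1 by simp
  then have den_pos: "0 < 6 * n * \<theta> * (1 - \<gamma>)\<^sup>2" using n \<theta>_pos by simp
  have \<sigma>_pos: "\<sigma> > 0"
    unfolding \<sigma>_eq n_def[symmetric] using rate_pos den_pos by (intro divide_pos_pos) (auto simp: mult.commute)

  have "\<sigma> * (a (Suc r))\<^sup>2 \<le> a r - a (Suc r)" for r
  proof -
    \<comment> \<open>\<open>w i\<close> is the iterate at which block \<open>i\<close> gets its
      turn in cycle \<open>r\<close>, and \<open>b\<close> collects the responses computed at these
      moments.\<close>
    define w where "w i = x (m * r + l i)" for i
    define b where "b = (\<chi> i. xhat (m * r + l i) $ i)"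
    define d where "d = b - x (m * r)"
    define y where "y = x (m * Suc r)"
    have yX: "y \<in> X" and wX: "w i \<in> X" for i using xX by (auto simp: y_def w_def)
    \<comment> \<open>Block \<open>i\<close> keeps its initial value until its turn, so its single
      move is along \<open>d $ i\<close>, although \<open>d\<close> is measured from the start of
      the cycle.\<close>
    have block: "x (m * r + k) $ i = (if l i < k then x (m * r) $ i + \<gamma> *\<^sub>R d $ i else x (m * r) $ i)"
      if "k \<le> m" for k i
      using that
    proof (induction k)
      case (Suc k)
      then show ?case
        using S[of k r] T[of k]
        by (auto simp: step relaxed_update_def d_def b_def less_Suc_eq)
    qed simp
    have w: "w i $ i = x (m * r) $ i" for i
      using block[of "l i" i] l(1)[of i] by (simp add: w_def)
    \<comment> \<open>The decreases within the cycle add up; at \<open>k = m\<close> every block has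
      been counted once.\<close>
    have "h (x (m * r + k)) \<le> h (x (m * r)) - \<gamma> * (\<tau> - \<gamma> * Lf) * (\<Sum>i | l i < k. (norm (d $ i))\<^sup>2)"
      if "k \<le> m" for k
      using that
    proof (induction k)
      case (Suc k)
      have "h (x (m * r + Suc k)) \<le> h (x (m * r + k)) - \<gamma> * (\<tau> - \<gamma> * Lf)
          * (\<Sum>i\<in>T k. (norm (xhat (m * r + k) $ i - x (m * r + k) $ i))\<^sup>2)"
        using sufficient_decrease[OF xX br, where I = "T k"] S[of k r] Suc by (simp add: step)
      also have "(\<Sum>i\<in>T k. (norm (xhat (m * r + k) $ i - x (m * r + k) $ i))\<^sup>2)
          = (\<Sum>i | l i = k. (norm (d $ i))\<^sup>2)"
        using T[of k] Suc block[of k] by (intro sum.cong) (auto simp: d_def b_def)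
      also have "h (x (m * r + k)) - \<gamma> * (\<tau> - \<gamma> * Lf) * (\<Sum>i | l i = k. (norm (d $ i))\<^sup>2)
          \<le> h (x (m * r)) - \<gamma> * (\<tau> - \<gamma> * Lf)
            * ((\<Sum>i | l i < k. (norm (d $ i))\<^sup>2) + (\<Sum>i | l i = k. (norm (d $ i))\<^sup>2))"
        using Suc by (simp only: distrib_left) simp
      also have "(\<Sum>i | l i < k. (norm (d $ i))\<^sup>2) + (\<Sum>i | l i = k. (norm (d $ i))\<^sup>2)
          = (\<Sum>i\<in>{i. l i < k} \<union> {i. l i = k}. (norm (d $ i))\<^sup>2)"
        by (intro sum.union_disjoint[symmetric]) auto
      also have "{i. l i < k} \<union> {i. l i = k} = {i. l i < Suc k}" by auto
      finally show ?case .
    qed simp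
    from this[of m] have "\<gamma> * (\<tau> - \<gamma> * Lf) * (norm d)\<^sup>2 \<le> a r - a (Suc r)"
      using l(1) by (simp add: a_def norm_vec_sq add.commute)
    moreover have "(a (Suc r))\<^sup>2 \<le> 6 * n * \<theta> * (1 - \<gamma>)\<^sup>2 * (norm d)\<^sup>2"
    proof -
      have y: "y $ i = x (m * r) $ i + \<gamma> *\<^sub>R d $ i" for i
        using block[of m i] l(1)[of i] by (simp add: y_def add.commute)
      have "y - b = (\<gamma> - 1) *\<^sub>R d"
        by (simp add: vec_eq_iff y d_def algebra_simps)
      then have yb: "norm (y - b) = (1 - \<gamma>) * norm d" "norm ((y - b) $ i) = (1 - \<gamma>) * norm (d $ i)" for i
        using \<gamma>1 by simp_all
      \<comment> \<open>The points \<open>y\<close> and \<open>w i\<close> differ only in blocks not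
        yet updated at \<open>w i\<close>, by \<open>\<gamma> *\<^sub>R d $ j\<close> in block
        \<open>j\<close>.\<close>
      have yw: "norm (y - w i) \<le> \<gamma> * norm d" for i
      proof -
        have "norm (y - w i) \<le> norm (\<gamma> *\<^sub>R d)"
          unfolding norm_vec_def using block[of "l i"] l(1)[of i]
          by (intro L2_set_mono) (auto simp: y w_def)
        then show ?thesis using step_size by simp
      qed
      have "a (Suc r) \<le> Lg * norm (y - b)
          + (\<Sum>i\<in>UNIV. (Lt * norm (y - w i) + L * norm ((y - b) $ i)) * norm ((y - xopt) $ i)
              + norm (gradft i (b $ i) (w i)) * norm ((y - b) $ i))"
        unfolding a_def y_def[symmetric]
        by (intro optimality_gap_delayed_le yX wX) (simp add: w_def b_def br)
      also have "\<dots> \<le> Lg * ((1 - \<gamma>) * norm d)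
          + (\<Sum>i\<in>UNIV. (Lt * (\<gamma> * norm d) + L * ((1 - \<gamma>) * norm (d $ i))) * norm ((y - xopt) $ i)
              + Qhat * ((1 - \<gamma>) * norm (d $ i)))"
        unfolding yb using yw Lipschitz_nonneg \<gamma>1 Q
        by (intro add_mono sum_mono mult_right_mono mult_left_mono order_refl)
          (auto simp: w_def b_def)
      also have "\<dots> = Lg * (1 - \<gamma>) * norm d + Lt * \<gamma> * norm d * (\<Sum>i\<in>UNIV. norm ((y - xopt) $ i))
          + L * (1 - \<gamma>) * (\<Sum>i\<in>UNIV. norm (d $ i) * norm ((y - xopt) $ i))
          + Qhat * (1 - \<gamma>) * (\<Sum>i\<in>UNIV. norm (d $ i))"
        by (simp add: sum.distrib sum_subtractf sum_distrib_left algebra_simps)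
      \<comment> \<open>The two sums of single norms cost a factor \<open>sqrt n\<close>; the sum of
        products is bounded by Cauchy-Schwarz without one.\<close>
      also have "\<dots> \<le> Lg * (1 - \<gamma>) * norm d + Lt * \<gamma> * norm d * (sqrt n * R)
          + L * (1 - \<gamma>) * (norm d * R) + Qhat * (1 - \<gamma>) * (sqrt n * norm d)"
      proof (intro add_mono mult_left_mono order_refl)
        have yR: "norm (y - xopt) \<le> R" unfolding y_def by (rule R)
        show "(\<Sum>i\<in>UNIV. norm ((y - xopt) $ i)) \<le> sqrt n * R"
          unfolding n_def using yR
          by (intro order_trans[OF sum_norm_le_sqrt_card] mult_left_mono) auto
        show "(\<Sum>i\<in>UNIV. norm (d $ i) * norm ((y - xopt) $ i)) \<le> norm d * R"
          using yR by (intro order_trans[OF sum_norm_mult_le] mult_left_mono) auto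
        show "(\<Sum>i\<in>UNIV. norm (d $ i)) \<le> sqrt n * norm d"
          unfolding n_def by (rule sum_norm_le_sqrt_card)
      qed (use Lipschitz_nonneg step_size \<gamma>1 Qhat in auto)
      also have "\<dots> = ((Lg * (1 - \<gamma>) + Lt * \<gamma> * (sqrt n * R))
          + (L * (1 - \<gamma>) * R + Qhat * (1 - \<gamma>) * sqrt n)) * norm d"
        by (simp add: algebra_simps)
      finally have "(a (Suc r))\<^sup>2 \<le> (((Lg * (1 - \<gamma>) + Lt * \<gamma> * (sqrt n * R))
          + (L * (1 - \<gamma>) * R + Qhat * (1 - \<gamma>) * sqrt n)) * norm d)\<^sup>2"
        using a_nonneg by (rule power_mono)
      also have "\<dots> = ((Lg * (1 - \<gamma>) + Lt * \<gamma> * (sqrt n * R))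
          + (L * (1 - \<gamma>) * R + Qhat * (1 - \<gamma>) * sqrt n))\<^sup>2 * (norm d)\<^sup>2"
        by (rule power_mult_distrib)
      also have "\<dots> \<le> (6 * n * \<theta> * (1 - \<gamma>)\<^sup>2) * (norm d)\<^sup>2"
      proof (intro mult_right_mono)
        \<comment> \<open>Up to factors \<open>n\<close>, these are the squares of the four
          summands. Two uses of \<open>power2_sum_le\<close> give the factor 4; the target equals
          \<open>6 * n * A + 12 * n * B + 12 * n * C + 6 * n * E\<close>, which dominates since
          \<open>n \<ge> 1\<close>.\<close>
        define A where "A = Lg\<^sup>2 * (1 - \<gamma>)\<^sup>2"
        define B where "B = Lt\<^sup>2 * \<gamma>\<^sup>2 * (n * R\<^sup>2)"
        define C where "C = L\<^sup>2 * (1 - \<gamma>)\<^sup>2 * R\<^sup>2"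
        define E where "E = Qhat\<^sup>2 * (1 - \<gamma>)\<^sup>2"
        have nonneg: "0 \<le> A" "0 \<le> B" "0 \<le> C" "0 \<le> E"
          using n by (auto simp: A_def B_def C_def E_def)
        have "((Lg * (1 - \<gamma>) + Lt * \<gamma> * (sqrt n * R))
            + (L * (1 - \<gamma>) * R + Qhat * (1 - \<gamma>) * sqrt n))\<^sup>2
          \<le> 2 * (2 * ((Lg * (1 - \<gamma>))\<^sup>2 + (Lt * \<gamma> * (sqrt n * R))\<^sup>2)
            + 2 * ((L * (1 - \<gamma>) * R)\<^sup>2 + (Qhat * (1 - \<gamma>) * sqrt n)\<^sup>2))"
          by (intro order_trans[OF power2_sum_le] mult_left_mono add_mono power2_sum_le) simp
        also have "\<dots> = 4 * A + 4 * B + 4 * C + 4 * (n * E)"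
          using n by (simp add: A_def B_def C_def E_def power_mult_distrib)
        also have "\<dots> \<le> 6 * (n * A) + 12 * (n * B) + 12 * (n * C) + 6 * (n * E)"
          using mult_right_mono[OF n nonneg(1)] mult_right_mono[OF n nonneg(2)]
            mult_right_mono[OF n nonneg(3)] mult_right_mono[OF n nonneg(4)] nonneg by linarith
        also have "\<dots> = 6 * n * \<theta> * (1 - \<gamma>)\<^sup>2"
          using \<gamma>1 by (simp add: A_def B_def C_def E_def \<theta>_eq n_def[symmetric] field_simps)
        finally show "((Lg * (1 - \<gamma>) + Lt * \<gamma> * (sqrt n * R))
            + (L * (1 - \<gamma>) * R + Qhat * (1 - \<gamma>) * sqrt n))\<^sup>2 \<le> 6 * n * \<theta> * (1 - \<gamma>)\<^sup>2" .
      qed simp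
      finally show ?thesis .
    qed
    then have "\<sigma> * (a (Suc r))\<^sup>2 \<le> \<sigma> * (6 * n * \<theta> * (1 - \<gamma>)\<^sup>2 * (norm d)\<^sup>2)"
      using \<sigma>_pos by (intro mult_left_mono) auto
    \<comment> \<open>The constant \<open>\<sigma>\<close> is the ratio of the decrease factor to
      the factor in the gap estimate.\<close>
    moreover have "\<sigma> * (6 * n * \<theta> * (1 - \<gamma>)\<^sup>2) = \<gamma> * (\<tau> - \<gamma> * Lf)"
      using n \<gamma>1 \<theta>_pos unfolding \<sigma>_eq n_def[symmetric] by (simp add: mult.commute)
    ultimately show ?thesis by (simp add: mult.assoc[symmetric])
  qed
  from quadratic_recursion_rate[of \<sigma> a, OF \<sigma>_pos a_nonneg this r]
  show ?thesis by (simp add: a_def x_0)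
qed

section \<open>The randomized rule\<close>

theorem randomized_rate:
  fixes M :: "'w measure" and x xhat :: "nat \<Rightarrow> 'w \<Rightarrow> 'a ^ 'n"
  assumes M: "prob_space M" and rule: "randomized_rule M x p p_min S"
    and iter: "\<And>\<omega>. \<omega> \<in> space M \<Longrightarrow>
      psca_iterates Xs ft g \<gamma> x0 (\<lambda>r. S r \<omega>) (\<lambda>r. x r \<omega>) (\<lambda>r. xhat r \<omega>)"
    and x0: "x0 \<in> X"
    and bounds: "\<And>\<omega>. \<omega> \<in> space M \<Longrightarrow>
      iterate_bounds gradf gradft xopt Q Qhat R (\<lambda>r. x r \<omega>) (\<lambda>r. xhat r \<omega>)"
    and Q: "Q > 0"
    and \<sigma>_eq: "\<sigma> = ((\<tau> - \<gamma> * Lf) * \<gamma> * p_min) /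
      (4 * ((Q + Lg)\<^sup>2 + real CARD('n) * L\<^sup>2 * R\<^sup>2))"
    and r: "r \<ge> 1"
  shows "prob_space.expectation M (\<lambda>\<omega>. h (x r \<omega>)) - h xopt
    \<le> Max {4 * \<sigma> - 2, h x0 - h xopt, 2} / \<sigma> * (1 / real r)"
proof -
  interpret prob_space M by (rule M)
  define C where "C = (Q + Lg)\<^sup>2 + real CARD('n) * L\<^sup>2 * R\<^sup>2"
  have "(Q + Lg)\<^sup>2 > 0" using Q Lipschitz_nonneg by (simp add: add_pos_nonneg)
  then have C: "C > 0" unfolding C_def by (intro add_pos_nonneg) auto
  have p_min: "p_min > 0" and S_meas: "\<And>k. S k \<in> measurable M (count_space UNIV)"
    using rule by (auto simp: randomized_rule_def)
  have S_prob: "AE \<omega> in M. p_min \<le>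
      real_cond_exp M (history_algebra M x k) (indicator {\<omega> \<in> space M. j \<in> S k \<omega>}) \<omega>" for k j
  proof -
    have "AE \<omega> in M. real_cond_exp M (history_algebra M x k)
        (indicator {\<omega> \<in> space M. j \<in> S k \<omega>}) \<omega> = p k j \<omega> \<and> p_min \<le> p k j \<omega>"
      using rule unfolding randomized_rule_def by blast
    then show ?thesis by eventually_elim simp
  qed
  have \<sigma>_pos: "\<sigma> > 0"
    unfolding \<sigma>_eq C_def[symmetric] using rate_pos p_min C by (auto simp: mult.commute)

  \<comment> \<open>The best-response map. Where no minimizer exists \<open>SOME\<close> is
    arbitrary, but only the values at iterates enter.\<close>
  define \<Phi> where "\<Phi> y = (\<chi> i. SOME b. best_response y i b)" for y
  have xX: "x k \<omega> \<in> X" if "\<omega> \<in> space M" for k \<omega>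
    using iter[OF that] x0 by (rule psca_iterates_in)
  have x_0: "x 0 \<omega> = x0" and br: "best_response (x k \<omega>) i (xhat k \<omega> $ i)"
    and step: "x (Suc k) \<omega> = relaxed_update \<gamma> (x k \<omega>) (xhat k \<omega>) (S k \<omega>)" if "\<omega> \<in> space M" for k i \<omega>
    using iter[OF that] by (auto simp: psca_iterates_iff)
  have xhat: "xhat k \<omega> = \<Phi> (x k \<omega>)" if "\<omega> \<in> space M" for k \<omega>
    unfolding vec_eq_iff \<Phi>_def
    using best_response_unique[OF xX[OF that] br[OF that]] someI[of "best_response (x k \<omega>) _", OF br[OF that]]
    by auto

  \<comment> \<open>Measurability of the iterates is not assumed: since best responses are unique, \<open>x k\<close> is a
    function of the finitely many possible selections made before step \<open>k\<close>.\<close>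
  have S_simple: "simple_function M (S k)" for k
    using measurable_sets[OF S_meas[of k]] by (auto simp: simple_function_def)
  have x_simple: "simple_function M (x k)" for k
  proof (induction k)
    case 0
    have "simple_function M (x 0) = simple_function M (\<lambda>_. x0)"
      by (rule simple_function_cong) (rule x_0)
    then show ?case by simp
  next
    case (Suc k)
    have "simple_function M (x (Suc k))
        = simple_function M (\<lambda>\<omega>. relaxed_update \<gamma> (x k \<omega>) (\<Phi> (x k \<omega>)) (S k \<omega>))"
      by (rule simple_function_cong) (simp add: step xhat)
    then show ?case
      using simple_function_compose2[OF Suc S_simple, of "\<lambda>y. relaxed_update \<gamma> y (\<Phi> y)" k]
      by simp
  qed
  have int: "integrable M (\<lambda>\<omega>. u (x k \<omega>))" for u :: "'a ^ 'n \<Rightarrow> real" and k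
    using x_simple by (rule integrable_simple_function[OF simple_function_compose1])

  \<comment> \<open>Expressed by \<open>\<Phi>\<close>, the squared distance in block
    \<open>j\<close> depends on \<open>x k\<close> alone. It is thus measurable for the history and
    separated from the selection \<open>S k\<close>.\<close>
  define D where "D j y = (norm (\<Phi> y $ j - y $ j))\<^sup>2" for j y
  have D_nonneg: "0 \<le> D j y" for j y by (simp add: D_def)
  define E where "E k j = {\<omega> \<in> space M. j \<in> S k \<omega>}" for k j
  have E: "E k j \<in> events" for k j
    using measurable_sets[OF S_meas[of k], of "{I. j \<in> I}"]
    by (simp add: E_def vimage_def Int_def conj_commute)
  have D_int: "integrable M (\<lambda>\<omega>. D j (x k \<omega>) * indicator (E k j) \<omega>)" for j k
    by (intro integrable_real_mult_indicator E int)

  have selected: "p_min * expectation (\<lambda>\<omega>. D j (x k \<omega>))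
      \<le> expectation (\<lambda>\<omega>. D j (x k \<omega>) * indicator (E k j) \<omega>)" for k j
  proof -
    let ?F = "history_algebra M x k"
    let ?G = "{x s -` B \<inter> space M | s B. s \<le> k \<and> B \<in> sets borel}"
    have G: "?G \<subseteq> events"
      using x_simple measurable_sets[OF measurable_simple_function[OF x_simple]] by auto
    then have "?G \<subseteq> Pow (space M)" using sets.space_closed by blast
    then have F: "space ?F = space M" "sets ?F = sigma_sets (space M) ?G"
      by (auto simp: history_algebra_def sets_measure_of space_measure_of)
    have sub: "subalgebra M ?F"
      unfolding subalgebra_def F using sets.sigma_sets_subset[OF G] by simp
    \<comment> \<open>Points are Borel sets, so the level sets of \<open>x k\<close> lie in the
      history; as \<open>x k\<close> has finite range, this gives its measurability there.\<close>
    have "x k -` {v} \<inter> space M \<in> sets ?F" for v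
      unfolding F by (intro sigma_sets.Basic CollectI exI[of _ k] exI[of _ "{v}"]) auto
    then have "simple_function ?F (x k)"
      using x_simple[of k] by (simp add: simple_function_def F)
    then have "(\<lambda>\<omega>. D j (x k \<omega>)) \<in> borel_measurable ?F"
      by (rule borel_measurable_simple_function[OF simple_function_compose1])
    then show ?thesis
      using S_prob[of k j] by (intro cond_prob_lower_bound[OF sub E] D_nonneg int) (auto simp: E_def)
  qed

  define \<beta> where "\<beta> = \<gamma> * (\<tau> - \<gamma> * Lf)"
  have \<beta>: "\<beta> > 0" using rate_pos by (simp add: \<beta>_def)
  define a where "a k = expectation (\<lambda>\<omega>. h (x k \<omega>)) - h xopt" for k
  have a_eq: "a k = expectation (\<lambda>\<omega>. h (x k \<omega>) - h xopt)" for k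
    using int by (simp add: a_def prob_space)
  have a_nonneg: "0 \<le> a k" for k
    unfolding a_eq using xopt_le[OF xX] by (intro integral_nonneg_AE) auto
  have decrease: "\<beta> * (p_min * expectation (\<lambda>\<omega>. \<Sum>j\<in>UNIV. D j (x k \<omega>))) \<le> a k - a (Suc k)" for k
  proof -
    \<comment> \<open>Pointwise only the selected blocks contribute; \<open>selected\<close> brings
      in the others after the expectation is taken.\<close>
    have "h (x (Suc k) \<omega>) \<le> h (x k \<omega>) - \<beta> * (\<Sum>j\<in>UNIV. D j (x k \<omega>) * indicator (E k j) \<omega>)"
      if \<omega>: "\<omega> \<in> space M" for \<omega>
    proof -
      have "(\<Sum>j\<in>UNIV. D j (x k \<omega>) * indicator (E k j) \<omega>)
          = (\<Sum>j\<in>UNIV. if j \<in> S k \<omega> then D j (x k \<omega>) else 0)"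
        using \<omega> by (intro sum.cong) (auto simp: E_def)
      also have "\<dots> = (\<Sum>j\<in>S k \<omega>. (norm (xhat k \<omega> $ j - x k \<omega> $ j))\<^sup>2)"
        using \<omega> by (simp add: sum.If_cases D_def xhat)
      finally show ?thesis
        using sufficient_decrease[OF xX[OF \<omega>] br[OF \<omega>], of k "S k \<omega>"] \<omega> by (simp add: step \<beta>_def)
    qed
    then have "expectation (\<lambda>\<omega>. h (x (Suc k) \<omega>))
        \<le> expectation (\<lambda>\<omega>. h (x k \<omega>) - \<beta> * (\<Sum>j\<in>UNIV. D j (x k \<omega>) * indicator (E k j) \<omega>))"
      by (intro integral_mono int Bochner_Integration.integrable_diff Bochner_Integration.integrable_sum
        integrable_mult_right D_int)
    also have "\<dots> = expectation (\<lambda>\<omega>. h (x k \<omega>))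
        - expectation (\<lambda>\<omega>. \<beta> * (\<Sum>j\<in>UNIV. D j (x k \<omega>) * indicator (E k j) \<omega>))"
      by (intro Bochner_Integration.integral_diff int integrable_mult_right
        Bochner_Integration.integrable_sum D_int)
    also have "expectation (\<lambda>\<omega>. \<beta> * (\<Sum>j\<in>UNIV. D j (x k \<omega>) * indicator (E k j) \<omega>))
        = \<beta> * expectation (\<lambda>\<omega>. \<Sum>j\<in>UNIV. D j (x k \<omega>) * indicator (E k j) \<omega>)"
      by (rule integral_mult_right_zero)
    also have "expectation (\<lambda>\<omega>. \<Sum>j\<in>UNIV. D j (x k \<omega>) * indicator (E k j) \<omega>)
        = (\<Sum>j\<in>UNIV. expectation (\<lambda>\<omega>. D j (x k \<omega>) * indicator (E k j) \<omega>))"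
      by (intro Bochner_Integration.integral_sum D_int)
    finally have "\<beta> * (\<Sum>j\<in>UNIV. expectation (\<lambda>\<omega>. D j (x k \<omega>) * indicator (E k j) \<omega>)) \<le> a k - a (Suc k)"
      by (simp add: a_def)
    moreover have "p_min * expectation (\<lambda>\<omega>. \<Sum>j\<in>UNIV. D j (x k \<omega>))
        = (\<Sum>j\<in>UNIV. p_min * expectation (\<lambda>\<omega>. D j (x k \<omega>)))"
      using int by (simp add: Bochner_Integration.integral_sum sum_distrib_left)
    then have "\<beta> * (p_min * expectation (\<lambda>\<omega>. \<Sum>j\<in>UNIV. D j (x k \<omega>)))
        \<le> \<beta> * (\<Sum>j\<in>UNIV. expectation (\<lambda>\<omega>. D j (x k \<omega>) * indicator (E k j) \<omega>))"
      using \<beta> selected by (auto intro!: mult_left_mono sum_mono)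
    ultimately show ?thesis by linarith
  qed
  have gap: "(a k)\<^sup>2 \<le> 2 * C * expectation (\<lambda>\<omega>. \<Sum>j\<in>UNIV. D j (x k \<omega>))" for k
  proof -
    have "(h (x k \<omega>) - h xopt)\<^sup>2 \<le> 2 * C * (\<Sum>j\<in>UNIV. D j (x k \<omega>))" if \<omega>: "\<omega> \<in> space M" for \<omega>
    proof -
      have "norm (gradf (x k \<omega>)) \<le> Q" and R: "norm (x k \<omega> - xopt) \<le> R"
        using bounds[OF \<omega>] by (auto simp: iterate_bounds_def)
      then have "norm (gradf (x k \<omega>)) + Lg + L * norm (x k \<omega> - xopt) \<le> Q + Lg + L * R"
        using Lipschitz_nonneg by (intro add_mono mult_left_mono) auto
      then have "h (x k \<omega>) - h xopt \<le> (Q + Lg + L * R) * norm (xhat k \<omega> - x k \<omega>)"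
        using optimality_gap_le[OF xX[OF \<omega>] br[OF \<omega>], of k]
        by (meson mult_right_mono norm_ge_zero order_trans)
      then have "(h (x k \<omega>) - h xopt)\<^sup>2 \<le> (Q + Lg + L * R)\<^sup>2 * (norm (xhat k \<omega> - x k \<omega>))\<^sup>2"
        using xopt_le[OF xX[OF \<omega>]] by (simp add: power_mult_distrib[symmetric] power_mono)
      also have "(Q + Lg + L * R)\<^sup>2 \<le> 2 * ((Q + Lg)\<^sup>2 + L\<^sup>2 * R\<^sup>2)"
        using power2_sum_le[of "Q + Lg" "L * R"] by (simp add: power_mult_distrib)
      \<comment> \<open>\<open>C\<close> carries the number of blocks, which is at least 1, in front
        of the last term.\<close>
      also have "\<dots> \<le> 2 * C"
        using mult_right_mono[of 1 "real CARD('n)" "L\<^sup>2 * R\<^sup>2"] by (simp add: C_def Suc_leI mult.assoc)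
      also have "(norm (xhat k \<omega> - x k \<omega>))\<^sup>2 = (\<Sum>j\<in>UNIV. D j (x k \<omega>))"
        using \<omega> by (simp add: norm_vec_sq D_def xhat)
      finally show ?thesis by (simp add: mult_right_mono)
    qed
    then have "expectation (\<lambda>\<omega>. (h (x k \<omega>) - h xopt)\<^sup>2)
        \<le> expectation (\<lambda>\<omega>. 2 * C * (\<Sum>j\<in>UNIV. D j (x k \<omega>)))"
      by (intro integral_mono int)
    moreover have "(a k)\<^sup>2 \<le> expectation (\<lambda>\<omega>. (h (x k \<omega>) - h xopt)\<^sup>2)"
      unfolding a_eq by (intro expectation_power2_le int)
    ultimately show ?thesis by simp
  qed
  have "\<sigma> * (a (Suc k))\<^sup>2 \<le> a k - a (Suc k)" for k
  proof -
    \<comment> \<open>\<open>\<sigma>\<close> is the ratio of the expected decrease factor to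
      \<open>4 * C\<close>, twice the factor in \<open>gap\<close>.\<close>
    have \<sigma>C: "\<sigma> * (4 * C) = \<beta> * p_min"
      unfolding \<sigma>_eq C_def[symmetric] \<beta>_def using C by (simp add: mult.commute)
    let ?e = "expectation (\<lambda>\<omega>. \<Sum>j\<in>UNIV. D j (x k \<omega>))"
    have e: "0 \<le> ?e" using D_nonneg by (intro integral_nonneg_AE) (auto intro!: sum_nonneg)
    have "0 \<le> \<beta> * (p_min * ?e)" using e \<beta> p_min by simp
    \<comment> \<open>The gap estimate concerns step \<open>k\<close>, while the recursion needs the
      square at \<open>Suc k\<close>; monotonicity connects them.\<close>
    then have "a (Suc k) \<le> a k" using decrease[of k] by linarith
    then have "(a (Suc k))\<^sup>2 \<le> (a k)\<^sup>2" using a_nonneg by (intro power_mono)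
    also have "\<dots> \<le> 2 * C * ?e" by (rule gap)
    also have "\<dots> \<le> 4 * C * ?e" using C e by simp
    finally have "\<sigma> * (a (Suc k))\<^sup>2 \<le> \<sigma> * (4 * C * ?e)"
      using \<sigma>_pos by simp
    also have "\<dots> = \<beta> * (p_min * ?e)" using \<sigma>C by (simp add: mult.assoc[symmetric])
    finally show ?thesis using decrease[of k] by linarith
  qed
  from quadratic_recursion_rate[of \<sigma> a, OF \<sigma>_pos a_nonneg this r]
  have "a r \<le> Max {4 * \<sigma> - 2, a 0, 2} / \<sigma> * (1 / real r)" .
  \<comment> \<open>The start equals \<open>x0\<close> on \<open>space M\<close>, so its expectation
    is that of a constant.\<close>
  moreover have "expectation (\<lambda>\<omega>. h (x 0 \<omega>)) = expectation (\<lambda>\<omega>. h x0)"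
    by (rule Bochner_Integration.integral_cong) (auto simp: x_0)
  then have "a 0 = h x0 - h xopt" by (simp add: a_def prob_space)
  ultimately show ?thesis by (simp add: a_def)
qed

end

section \<open>Both rates from the hypotheses on the problem\<close>

theorem theorem2:
  fixes V Xs :: "'n::finite \<Rightarrow> 'a::euclidean_space set"
    and f :: "'a ^ 'n \<Rightarrow> real" and gradf :: "'a ^ 'n \<Rightarrow> 'a ^ 'n"
    and g :: "'n \<Rightarrow> 'a \<Rightarrow> real"
    and ft :: "'n \<Rightarrow> 'a \<Rightarrow> 'a ^ 'n \<Rightarrow> real" and gradft :: "'n \<Rightarrow> 'a \<Rightarrow> 'a ^ 'n \<Rightarrow> 'a"
    and X :: "('a ^ 'n) set" and h :: "'a ^ 'n \<Rightarrow> real"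
    and x0 xopt :: "'a ^ 'n"
    and Lf Lt Lg L \<tau> \<gamma> Q Qhat R p_min \<sigma> \<theta> \<sigma>t :: real and Li :: "'n \<Rightarrow> real"
    and M :: "'w measure" and S :: "nat \<Rightarrow> 'w \<Rightarrow> 'n set" and p :: "nat \<Rightarrow> 'n \<Rightarrow> 'w \<Rightarrow> real"
    and x xhat :: "nat \<Rightarrow> 'w \<Rightarrow> 'a ^ 'n"
    and m :: nat and T Sc :: "nat \<Rightarrow> 'n set" and xc xchat :: "nat \<Rightarrow> 'a ^ 'n"
  assumes X_eq: "X = block_prod Xs"
    and h_eq: "h = objective f g"
    and V: "\<And>i. subspace (V i)"
    and Xs: "\<And>i. Xs i \<subseteq> V i" "\<And>i. Xs i \<noteq> {}" "\<And>i. closed (Xs i)" "\<And>i. convex (Xs i)"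
    and f_diff: "cont_diff_on X f gradf" "\<And>y i. y \<in> X \<Longrightarrow> gradf y $ i \<in> V i"
    and f_convex: "convex_on X f"
    and g_convex: "\<And>i. convex_on (V i) (g i)"
    and gradf_lipschitz: "lipschitz_on Lf X gradf"
    and h_bdd: "bdd_below (h ` X)"
    and \<tau>_pos: "\<tau> > 0"
    and ft_diff: "\<And>i y. y \<in> X \<Longrightarrow> cont_diff_on (Xs i) (\<lambda>z. ft i z y) (\<lambda>z. gradft i z y)"
      "\<And>i z y. z \<in> Xs i \<Longrightarrow> y \<in> X \<Longrightarrow> gradft i z y \<in> V i"
    and ft_strong: "\<And>i y. y \<in> X \<Longrightarrow>
      strongly_convex_on \<tau> (Xs i) (\<lambda>z. ft i z y) (\<lambda>z. gradft i z y)"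
    and ft_consistent: "\<And>i y. y \<in> X \<Longrightarrow> gradft i (y $ i) y = gradf y $ i"
    and gradft_lipschitz2: "\<And>i z. z \<in> Xs i \<Longrightarrow> lipschitz_on Lt X (\<lambda>y. gradft i z y)"
    and gradft_lipschitz1: "\<And>i y. y \<in> X \<Longrightarrow> lipschitz_on (Li i) (Xs i) (\<lambda>z. gradft i z y)"
    and g_lipschitz: "lipschitz_on Lg X (block_sum g)"
    and step_size: "0 < \<gamma>" "\<gamma> \<le> 1" "\<gamma> * Lf < \<tau>"
    and x0: "x0 \<in> X"
    and level_compact: "compact {y \<in> X. h y \<le> h x0}"
    and xopt: "is_arg_min h (\<lambda>y. y \<in> X) xopt"
    and bound_pos: "Q > 0" "Qhat > 0" "R > 0"
    and L_eq: "L = (MAX i. Li i)"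
    and \<sigma>_eq: "\<sigma> = ((\<tau> - \<gamma> * Lf) * \<gamma> * p_min) /
      (4 * ((Q + Lg)\<^sup>2 + real CARD('n) * L\<^sup>2 * R\<^sup>2))"
    and \<theta>_eq: "\<theta> = Lg\<^sup>2 + Qhat\<^sup>2 +
      2 * real CARD('n) * R\<^sup>2 * Lt\<^sup>2 * (\<gamma>\<^sup>2 / (1 - \<gamma>)\<^sup>2) + 2 * R\<^sup>2 * L\<^sup>2"
    and \<sigma>t_eq: "\<sigma>t = ((\<tau> - \<gamma> * Lf) * \<gamma>) / (6 * real CARD('n) * \<theta> * (1 - \<gamma>)\<^sup>2)"
  shows
    "(prob_space M \<and> randomized_rule M x p p_min S \<and>
      (\<forall>\<omega>\<in>space M.
         psca_iterates Xs ft g \<gamma> x0 (\<lambda>r. S r \<omega>) (\<lambda>r. x r \<omega>) (\<lambda>r. xhat r \<omega>) \<and>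
         iterate_bounds gradf gradft xopt Q Qhat R (\<lambda>r. x r \<omega>) (\<lambda>r. xhat r \<omega>))
      \<longrightarrow> (\<forall>r\<ge>1. prob_space.expectation M (\<lambda>\<omega>. h (x r \<omega>)) - h xopt
              \<le> Max {4 * \<sigma> - 2, h x0 - h xopt, 2} / \<sigma> * (1 / real r)))
     \<and>
     (\<gamma> < 1 \<and> cyclic_rule m T Sc \<and>
      psca_iterates Xs ft g \<gamma> x0 Sc xc xchat \<and>
      iterate_bounds gradf gradft xopt Q Qhat R xc xchat
      \<longrightarrow> (\<forall>r\<ge>1. h (xc (m * r)) - h xopt
              \<le> Max {4 * \<sigma>t - 2, h x0 - h xopt, 2} / \<sigma>t * (1 / real r)))"
proof -
  \<comment> \<open>The maximum over the blocks provides the common Lipschitz constant of the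
    locale.\<close>
  have Li: "Li i \<le> L" for i unfolding L_eq by (intro Max_ge) auto
  interpret psca_problem Xs f gradf g ft gradft Lf Lt Lg L \<tau> \<gamma> xopt
  proof
    show "convex_on (Xs i) (g i)" for i
      using g_convex Xs(1) Xs(4) by (rule convex_on_subset)
    show "lipschitz_on L (Xs i) (\<lambda>z. gradft i z y)" if "y \<in> block_prod Xs" for i y
      using gradft_lipschitz1[of y i] that Li by (auto simp: X_eq intro: lipschitz_on_le)
  qed (use assms in \<open>auto simp: X_eq h_eq\<close>)
  show ?thesis
  proof (intro conjI impI allI, goal_cases)
    case (1 r)
    then show ?case
      unfolding h_eq using x0 bound_pos X_eq
      by (intro randomized_rate[where p = p and S = S and xhat = xhat and Q = Q and Qhat = Qhat
            and R = R and p_min = p_min, OF _ _ _ _ _ _ \<sigma>_eq]) auto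
  next
    case (2 r)
    then show ?case
      unfolding h_eq using x0 bound_pos X_eq
      by (intro cyclic_rate[where T = T and S = Sc and xhat = xchat and Qhat = Qhat
            and R = R, OF _ _ _ _ _ _ \<theta>_eq \<sigma>t_eq]) auto
  qed
qed

end
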